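(* Let $r,s,k$ be integers with $0\le r,s\le k$. If $r\le s$, then as formal power series \[ \sum_{n\ge0}\mu^{\le k}_{n,r,s}x^n=\frac{P^*_r(x)\,\delta^{s+1}P^*_{k-s}(x)}{P^*_{k+1}(x)}\cdot x^{s-r}. \] If $r>s$, then \[ \sum_{n\ge0}\mu^{\le k}_{n,r,s}x^n=\frac{P^*_s(x)\,\delta^{r+1}P^*_{k-r}(x)}{P^*_{k+1}(x)}\cdot\prod_{i=s+1}^{r}(a_i+\lambda_ix). \]
   Context: Let $b=\{b_n\}_{n\ge0}$, $a=\{a_n\}_{n\ge0}$, $\lambda=\{\lambda_n\}_{n\ge0}$ be sequences of complex numbers. Let $P_n(x)=P_n(x;b,a,\lambda)$ be defined by $P_{-1}=0$, $P_0=1$, $P_{n+1}(x)=(x-b_n)P_n(x)-(a_nx+\lambda_n)P_{n-1}(x)$, and let $P^*_n(x)=P^*_n(x;b,a,\lambda)=x^nP_n(1/x)$ (so $P^*_n(0)=1$). For a sequence $s=\{s_n\}_{n\ge0}$ let $\delta s=\{s_{n+1}\}_{n\ge0}$, and $\delta^jP^*_n(x)=P^*_n(x;\delta^jb,\delta^ja,\delta^j\lambda)$. A Motzkin–Schröder path is a lattice path never going below the $x$-axis with steps up $(1,1)$, horizontal $(1,0)$, vertical down $(0,-1)$, diagonal down $(1,-1)$; its weight is the product of step weights, where up steps have weight $1$, a horizontal step starting at height $h$ has weight $b_h$, a vertical down step starting at height $h$ has weight $a_h$, and a diagonal down step starting at height $h$ has weight $\lambda_h$. Let $\mu^{\le k}_{n,r,s}$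 be the sum of weights of all Motzkin–Schröder paths from $(0,r)$ to $(n,s)$ all of whose points have $y$-coordinate at most $k$. *)

theory Defs
  imports Complex_Main "HOL-Computational_Algebra.Computational_Algebra"
begin

text \<open>The polynomials \<open>P\<^sub>n(x; b, a, \<lambda>)\<close>. The clause for index 1 is the recurrence at
  \<open>n = 0\<close>, where the second term vanishes because \<open>P\<^sub>-\<^sub>1 = 0\<close>.\<close>

fun rec_poly ::
  "(nat \<Rightarrow> complex) \<Rightarrow> (nat \<Rightarrow> complex) \<Rightarrow> (nat \<Rightarrow> complex) \<Rightarrow> nat \<Rightarrow> complex poly" where
  "rec_poly b a l 0 = 1"
| "rec_poly b a l (Suc 0) = [:- b 0, 1:]"
| "rec_poly b a l (Suc (Suc n)) =
     [:- b (Suc n), 1:] * rec_poly b a l (Suc n) - [:l (Suc n), a (Suc n):] * rec_poly b a l n"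

text \<open>\<open>x\<^sup>n P\<^sub>n(1/x)\<close>. The degree of \<open>P\<^sub>n\<close> is \<open>n\<close>, so this is coefficient reversal;
  see \<open>poly_rec_poly_star\<close> below.\<close>

definition rec_poly_star ::
  "(nat \<Rightarrow> complex) \<Rightarrow> (nat \<Rightarrow> complex) \<Rightarrow> (nat \<Rightarrow> complex) \<Rightarrow> nat \<Rightarrow> complex poly" where
  "rec_poly_star b a l n = reflect_poly (rec_poly b a l n)"

definition seq_shift :: "(nat \<Rightarrow> complex) \<Rightarrow> nat \<Rightarrow> complex" where
  "seq_shift t = (\<lambda>n. t (Suc n))"

definition shifted_rec_poly_star ::
  "nat \<Rightarrow> (nat \<Rightarrow> complex) \<Rightarrow> (nat \<Rightarrow> complex) \<Rightarrow> (nat \<Rightarrow> complex) \<Rightarrow> nat \<Rightarrow> complex poly" where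
  "shifted_rec_poly_star j b a l n =
     rec_poly_star ((seq_shift ^^ j) b) ((seq_shift ^^ j) a) ((seq_shift ^^ j) l) n"

lemma rec_poly_monic: "degree (rec_poly b a l n) = n \<and> lead_coeff (rec_poly b a l n) = 1"
proof (induction b a l n rule: rec_poly.induct)
  case (3 b a l n)
  let ?A = "[:- b (Suc n), 1:] * rec_poly b a l (Suc n)"
  let ?B = "[:l (Suc n), a (Suc n):] * rec_poly b a l n"
  have nz: "rec_poly b a l (Suc n) \<noteq> 0"
    using 3 by auto
  have A: "degree ?A = Suc (Suc n)"
    using 3 nz by (subst degree_mult_eq) auto
  have lA: "lead_coeff ?A = 1"
    using 3 by (subst lead_coeff_mult) auto
  have "degree ?B \<le> degree [:l (Suc n), a (Suc n):] + degree (rec_poly b a l n)"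
    by (rule degree_mult_le)
  also have "\<dots> \<le> 1 + n"
    using 3 by (intro add_mono) auto
  finally have B: "degree ?B < Suc (Suc n)"
    by simp
  have "degree (?A + - ?B) = degree ?A"
    using A B by (intro degree_add_eq_left) (simp only: degree_minus)
  hence d: "degree (?A - ?B) = Suc (Suc n)"
    by (simp only: A diff_conv_add_uminus)
  have "coeff (?A - ?B) (Suc (Suc n)) = 1"
    using lA B unfolding A coeff_diff by (simp only: coeff_eq_0 diff_0_right)
  with d show ?case
    by (simp only: rec_poly.simps)
qed simp_all

lemma poly_rec_poly_star:
  assumes "x \<noteq> 0"
  shows "poly (rec_poly_star b a l n) x = x ^ n * poly (rec_poly b a l n) (1 / x)"
  using assms rec_poly_monic[of b a l n]
  by (simp add: rec_poly_star_def poly_reflect_poly_nz inverse_eq_divide)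


datatype ms_step = Up | Horizontal | Vertical_Down | Diagonal_Down

fun ms_move :: "ms_step \<Rightarrow> int \<times> int \<Rightarrow> int \<times> int" where
  "ms_move Up (x, y) = (x + 1, y + 1)"
| "ms_move Horizontal (x, y) = (x + 1, y)"
| "ms_move Vertical_Down (x, y) = (x, y - 1)"
| "ms_move Diagonal_Down (x, y) = (x + 1, y - 1)"

text \<open>A path is represented by its starting point together with its list of steps.\<close>

fun ms_points :: "int \<times> int \<Rightarrow> ms_step list \<Rightarrow> (int \<times> int) list" where
  "ms_points p [] = [p]"
| "ms_points p (t # w) = p # ms_points (ms_move t p) w"

definition ms_paths :: "int \<times> int \<Rightarrow> int \<times> int \<Rightarrow> ms_step list set" where
  "ms_paths p q = {w. last (ms_points p w) = q \<and> (\<forall>(x, y)\<in>set (ms_points p w). 0 \<le> y)}"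

definition bounded_ms_paths :: "nat \<Rightarrow> int \<times> int \<Rightarrow> int \<times> int \<Rightarrow> ms_step list set" where
  "bounded_ms_paths k p q = {w \<in> ms_paths p q. \<forall>(x, y)\<in>set (ms_points p w). y \<le> int k}"

fun ms_step_weight ::
  "(nat \<Rightarrow> complex) \<Rightarrow> (nat \<Rightarrow> complex) \<Rightarrow> (nat \<Rightarrow> complex) \<Rightarrow> nat \<Rightarrow> ms_step \<Rightarrow> complex" where
  "ms_step_weight b a l h Up = 1"
| "ms_step_weight b a l h Horizontal = b h"
| "ms_step_weight b a l h Vertical_Down = a h"
| "ms_step_weight b a l h Diagonal_Down = l h"

fun ms_weight ::
  "(nat \<Rightarrow> complex) \<Rightarrow> (nat \<Rightarrow> complex) \<Rightarrow> (nat \<Rightarrow> complex) \<Rightarrow>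
     int \<times> int \<Rightarrow> ms_step list \<Rightarrow> complex" where
  "ms_weight b a l p [] = 1"
| "ms_weight b a l p (t # w) =
     ms_step_weight b a l (nat (snd p)) t * ms_weight b a l (ms_move t p) w"

definition bounded_moment ::
  "(nat \<Rightarrow> complex) \<Rightarrow> (nat \<Rightarrow> complex) \<Rightarrow> (nat \<Rightarrow> complex) \<Rightarrow>
     nat \<Rightarrow> nat \<Rightarrow> nat \<Rightarrow> nat \<Rightarrow> complex" where
  "bounded_moment b a l k n r s =
     (\<Sum>w\<in>bounded_ms_paths k (0, int r) (int n, int s). ms_weight b a l (0, int r) w)"

lemma ms_points_nonempty [simp]: "ms_points p w \<noteq> []"
  by (cases w) auto

lemma length_ms_path:
  "int (length w) \<le> 2 * (fst (last (ms_points p w)) - fst p) + (snd p - snd (last (ms_points p w)))"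
proof (induction w arbitrary: p)
  case (Cons t w)
  show ?case
    using Cons.IH[of "ms_move t p"] by (cases t; cases p) auto
qed simp

text \<open>The sum defining \<^const>\<open>bounded_moment\<close> is over a finite set.\<close>

lemma finite_ms_paths: "finite (ms_paths p q)"
proof (rule finite_subset)
  have "(UNIV :: ms_step set) = {Up, Horizontal, Vertical_Down, Diagonal_Down}"
    using ms_step.exhaust by auto
  hence "finite (UNIV :: ms_step set)"
    by (metis finite.emptyI finite.insertI)
  thus "finite {w :: ms_step list. set w \<subseteq> UNIV \<and>
      length w \<le> nat (2 * (fst q - fst p) + (snd p - snd q))}"
    by (rule finite_lists_length_le)
  show "ms_paths p q \<subseteq> {w. set w \<subseteq> UNIV \<and>
      length w \<le> nat (2 * (fst q - fst p) + (snd p - snd q))}"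
  proof
    fix w assume "w \<in> ms_paths p q"
    hence "last (ms_points p w) = q"
      by (simp add: ms_paths_def)
    with length_ms_path[of w p]
    show "w \<in> {w. set w \<subseteq> UNIV \<and> length w \<le> nat (2 * (fst q - fst p) + (snd p - snd q))}"
      by auto
  qed
qed

lemma finite_bounded_ms_paths: "finite (bounded_ms_paths k p q)"
  using finite_ms_paths[of p q] by (simp add: bounded_ms_paths_def)

end

theory Submission
  imports Defs
begin

text \<open>Decomposing a path at its first step gives a linear system for the generating functions
  \<open>F\<^sub>r = \<Sum>\<^sub>n \<mu>\<^sub>n\<^sub>,\<^sub>r\<^sub>,\<^sub>s x\<^sup>n\<close> with fixed \<open>s\<close> and \<open>k\<close>, namely
  \<open>(1 - b\<^sub>r x) F\<^sub>r = [r = s] + x F\<^sub>r\<^sub>+\<^sub>1 + (a\<^sub>r + \<lambda>\<^sub>r x) F\<^sub>r\<^sub>-\<^sub>1\<close> for \<open>r \<le> k\<close>, where out-of-range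
  terms vanish. It determines the coefficients recursively, so it has at most one solution. The
  reversed polynomials are continuants: they can be expanded at either end, and the claimed
  formula solves the system for \<open>r < s\<close> by the expansion at the last index, for \<open>r > s\<close> by the
  expansion at the first index, and for \<open>r = s\<close> by Euler's identity
  \<open>P\<^sup>*\<^sub>k\<^sub>+\<^sub>1 = P\<^sup>*\<^sub>j \<delta>\<^sup>jP\<^sup>*\<^sub>k\<^sub>+\<^sub>1\<^sub>-\<^sub>j - x (a\<^sub>j + \<lambda>\<^sub>j x) P\<^sup>*\<^sub>j\<^sub>-\<^sub>1 \<delta>\<^sup>j\<^sup>+\<^sup>1P\<^sup>*\<^sub>k\<^sub>-\<^sub>j\<close>.\<close>

section \<open>Reversed polynomials and their expansions at both ends\<close>

text \<open>Transfers recurrences to the reversed polynomials, whose values are known as x^n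
  P_n(1/x) only for nonzero x. Multiplying both sides by the variable makes them agree at 0 as
  well.\<close>

lemma poly_eqI_nonzero:
  fixes p q :: "'a :: {idom, ring_char_0} poly"
  assumes "\<And>x. x \<noteq> 0 \<Longrightarrow> poly p x = poly q x"
  shows "p = q"
proof -
  have "poly ([:0, 1:] * p) x = poly ([:0, 1:] * q) x" for x
    using assms[of x] by (cases "x = 0") auto
  then have "[:0, 1:] * p = [:0, 1:] * q"
    by (intro iffD1[OF poly_eq_poly_eq_iff] ext)
  then show ?thesis
    by (simp only: mult_cancel_left) simp
qed

lemma rec_poly_star_0: "rec_poly_star b a l 0 = 1"
  by (simp add: rec_poly_star_def)

lemma rec_poly_star_1: "rec_poly_star b a l (Suc 0) = [:1, - b 0:]"
  by (rule poly_eqI_nonzero) (simp add: poly_rec_poly_star field_simps)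

lemma rec_poly_star_Suc_Suc:
  "rec_poly_star b a l (Suc (Suc n)) =
     [:1, - b (Suc n):] * rec_poly_star b a l (Suc n)
     - [:0, a (Suc n), l (Suc n):] * rec_poly_star b a l n"
  by (rule poly_eqI_nonzero) (simp add: poly_rec_poly_star field_simps)

lemma coeff_0_rec_poly_star: "coeff (rec_poly_star b a l n) 0 = 1"
  using rec_poly_monic[of b a l n] by (metis coeff_0_reflect_poly rec_poly_star_def)

text \<open>Expansion at the first index. It commutes with the expansion at the last index, so it
  propagates by two-step induction.\<close>

lemma rec_poly_star_Suc_Suc_shift:
  "rec_poly_star b a l (Suc (Suc n)) =
     [:1, - b 0:] * rec_poly_star (seq_shift b) (seq_shift a) (seq_shift l) (Suc n)
     - [:0, a (Suc 0), l (Suc 0):] *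
         rec_poly_star (seq_shift (seq_shift b)) (seq_shift (seq_shift a)) (seq_shift (seq_shift l)) n"
proof (induction n rule: less_induct)
  case (less n)
  consider "n = 0" | "n = Suc 0" | m where "n = Suc (Suc m)"
    by (metis old.nat.exhaust)
  then show ?case
  proof cases
    case 3
    then have "m < n" "Suc m < n" by simp_all
    \<comment> \<open>The left side is expanded first at the last index and then, by induction, at
      the first; the right side is expanded at the last index. What remains is a ring
      identity.\<close>
    show ?thesis
      unfolding 3 rec_poly_star_Suc_Suc[of b a l "Suc (Suc m)"]
        less.IH[OF \<open>Suc m < n\<close>] less.IH[OF \<open>m < n\<close>]
        rec_poly_star_Suc_Suc[of "seq_shift b" _ _ "Suc m"]
        rec_poly_star_Suc_Suc[of "seq_shift (seq_shift b)" _ _ m]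
      by (simp only: seq_shift_def) algebra
  qed (simp_all add: rec_poly_star_0 rec_poly_star_1 rec_poly_star_Suc_Suc seq_shift_def algebra_simps)
qed

lemma seq_shift_funpow: "(seq_shift ^^ j) t n = t (n + j)"
  by (induction j arbitrary: n) (simp_all add: seq_shift_def)

lemma shifted_rec_poly_star_0: "shifted_rec_poly_star j b a l 0 = 1"
  by (simp add: shifted_rec_poly_star_def rec_poly_star_0)

lemma shifted_rec_poly_star_1: "shifted_rec_poly_star j b a l (Suc 0) = [:1, - b j:]"
  by (simp add: shifted_rec_poly_star_def rec_poly_star_1 seq_shift_funpow)

lemma shifted_rec_poly_star_Suc_Suc:
  "shifted_rec_poly_star j b a l (Suc (Suc n)) =
     [:1, - b j:] * shifted_rec_poly_star (Suc j) b a l (Suc n)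
     - [:0, a (Suc j), l (Suc j):] * shifted_rec_poly_star (Suc (Suc j)) b a l n"
  by (simp add: shifted_rec_poly_star_def rec_poly_star_Suc_Suc_shift[of _ _ _ n] seq_shift_funpow)

section \<open>Continuants solving the tridiagonal system\<close>

text \<open>Intended reading: \<open>p i\<close> is P*_i, \<open>q j\<close> is the j-fold shift of
  P*_(k+1-j), and \<open>N\<close> is the numerator of the claimed formula for fixed
  \<open>s\<close>. The value \<open>q (Suc (Suc k)) = 0\<close> stands for P*_(-1) and makes the
  recurrence for \<open>q\<close> meaningful at \<open>j = k\<close>.\<close>

lemma continuant_system:
  fixes p q c \<beta> :: "nat \<Rightarrow> 'a :: comm_ring_1" and x :: 'a
  assumes p0: "p 0 = 1" and p1: "p (Suc 0) = \<beta> 0"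
    and p: "\<And>n. p (Suc (Suc n)) = \<beta> (Suc n) * p (Suc n) - x * c (Suc n) * p n"
    and qk1: "q (Suc k) = 1" and qk2: "q (Suc (Suc k)) = 0"
    and q: "\<And>j. j \<le> k \<Longrightarrow> q j = \<beta> j * q (Suc j) - x * c (Suc j) * q (Suc (Suc j))"
    and N: "\<And>r. N r = (if r \<le> s then p r * q (Suc s) * x ^ (s - r)
                        else p s * q (Suc r) * (\<Prod>i=s+1..r. c i))"
    and "r \<le> k" "s \<le> k"
  shows "\<beta> r * N r = (if r = s then p (Suc k) else 0) + x * N (Suc r)
           + (if r = 0 then 0 else c r * N (r - 1))"
proof -
  \<comment> \<open>At \<open>j = k\<close> the boundary values of \<open>q\<close> make this
    trivial. Descending from \<open>Suc n\<close> to \<open>n\<close> expands \<open>p\<close> at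
    its last index and recombines two terms into \<open>q (Suc n)\<close>.\<close>
  have euler: "p (Suc k) = p (Suc j) * q (Suc j) - x * c (Suc j) * p j * q (Suc (Suc j))"
    if "j \<le> k" for j
    using that
  proof (induction rule: inc_induct)
    case base
    show ?case by (simp add: qk1 qk2)
  next
    case (step n)
    then have "Suc n \<le> k" by simp
    show ?case
      unfolding step.IH p[of n] q[OF \<open>Suc n \<le> k\<close>] by (simp add: algebra_simps)
  qed
  consider "r < s" | "r = s" | "r > s" by linarith
  then show ?thesis
  proof cases
    case 1
    \<comment> \<open>Below the diagonal height \<open>s\<close>, the row is the recurrence for
      \<open>p\<close> times \<open>q (Suc s) * x ^ (s - r)\<close>; \<open>d\<close> makes the
      powers of \<open>x\<close> explicit.\<close>
    then obtain d where s: "s = Suc (r + d)"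
      using less_iff_Suc_add by auto
    show ?thesis
    proof (cases r)
      case 0
      then show ?thesis by (simp add: N s p0 p1 algebra_simps)
    next
      case (Suc m)
      then show ?thesis
        by (simp add: N s p[of m] Suc_diff_le algebra_simps)
    qed
  next
    case 2
    \<comment> \<open>Here \<open>N r\<close> and \<open>N (Suc r)\<close> come from different
      branches; their mismatch is exactly Euler's identity at \<open>j = s\<close>.\<close>
    show ?thesis
    proof (cases r)
      case 0
      then show ?thesis
        using 2 euler[of 0] by (simp add: N p0 p1 algebra_simps)
    next
      case (Suc m)
      then show ?thesis
        using 2 euler[of s] p[of m] assms(9) by (simp add: N algebra_simps)
    qed
  next
    case 3
    then obtain m where m: "r = Suc m" "s \<le> m"
      by (cases r) auto
    have C: "(\<Prod>i=s+1..m. c i) * c r = (\<Prod>i=s+1..r. c i)"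
      using m by simp
    \<comment> \<open>For \<open>m = s\<close> the first branch of \<open>N\<close> applies, but it
      agrees with this form: the power of \<open>x\<close> is 1 and the product is empty.\<close>
    have N_pred: "N m = p s * q r * (\<Prod>i=s+1..m. c i)"
      using m by (cases "s = m") (simp_all add: N)
    have N_succ: "N (Suc r) = p s * q (Suc (Suc r)) * ((\<Prod>i=s+1..r. c i) * c (Suc r))"
      using 3 by (simp add: N)
    have N_r: "N r = p s * q (Suc r) * (\<Prod>i=s+1..r. c i)"
      using 3 by (simp add: N)
    \<comment> \<open>This is the recurrence for \<open>q\<close> at \<open>r\<close>, times
      \<open>p s\<close> and the product up to \<open>r\<close>.\<close>
    have "\<beta> r * N r = x * N (Suc r) + c r * N m"
      unfolding N_pred N_succ N_r C[symmetric] q[OF \<open>r \<le> k\<close>] by (simp add: algebra_simps)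
    then show ?thesis
      using m 3 by simp
  qed
qed

section \<open>Uniqueness of the power series solution\<close>

lemma fps_tridiagonal_row_iff:
  fixes f g e u :: "'a :: comm_ring_1 fps"
  shows "(1 - fps_const \<beta> * fps_X) * f =
      e + u + (if P then 0 else (fps_const \<alpha> + fps_const \<gamma> * fps_X) * g) \<longleftrightarrow>
    f = e + fps_const \<beta> * (fps_X * f) + u
      + (if P then 0 else fps_const \<alpha> * g + fps_const \<gamma> * (fps_X * g))"
  by (simp add: algebra_simps)

text \<open>Coefficient \<open>n\<close> in row \<open>r\<close> depends on coefficients
  \<open>n - 1\<close> and, through \<open>a r\<close>, on coefficient \<open>n\<close> of row
  \<open>r - 1\<close>. Hence induction on \<open>n\<close>, and within it on
  \<open>r\<close>.\<close>

lemma fps_tridiagonal_system_unique: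
  fixes F G E :: "nat \<Rightarrow> 'a :: comm_ring_1 fps"
  assumes F: "\<And>r. r \<le> k \<Longrightarrow> (1 - fps_const (b r) * fps_X) * F r =
        E r + (if r < k then fps_X * F (Suc r) else 0)
        + (if r = 0 then 0 else (fps_const (a r) + fps_const (l r) * fps_X) * F (r - 1))"
    and G: "\<And>r. r \<le> k \<Longrightarrow> (1 - fps_const (b r) * fps_X) * G r =
        E r + (if r < k then fps_X * G (Suc r) else 0)
        + (if r = 0 then 0 else (fps_const (a r) + fps_const (l r) * fps_X) * G (r - 1))"
    and "r \<le> k"
  shows "F r = G r"
proof -
  have expand: "H r $ n = E r $ n + (if n = 0 then 0 else b r * H r $ (n - 1))
      + (if r < k \<and> n > 0 then H (Suc r) $ (n - 1) else 0)
      + (if r = 0 then 0 else a r * H (r - 1) $ n + (if n = 0 then 0 else l r * H (r - 1) $ (n - 1)))"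
    if "(1 - fps_const (b r) * fps_X) * H r =
        E r + (if r < k then fps_X * H (Suc r) else 0)
        + (if r = 0 then 0 else (fps_const (a r) + fps_const (l r) * fps_X) * H (r - 1))"
    for H r n
  proof -
    have "H r = E r + fps_const (b r) * (fps_X * H r) + (if r < k then fps_X * H (Suc r) else 0)
        + (if r = 0 then 0 else fps_const (a r) * H (r - 1) + fps_const (l r) * (fps_X * H (r - 1)))"
      using that by (simp only: fps_tridiagonal_row_iff)
    from arg_cong[OF this, of "\<lambda>f. f $ n"] show ?thesis
      by (simp split: if_splits)
  qed
  have "\<forall>r\<le>k. F r $ n = G r $ n" for n
  proof (induction n rule: less_induct)
    case (less n)
    have "r \<le> k \<longrightarrow> F r $ n = G r $ n" for r
    proof (induction r)
      case 0
      show ?case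
        using less.IH[of "n - 1"]
        by (auto simp: expand[where H = F and r = 0 and n = n, OF F]
            expand[where H = G and r = 0 and n = n, OF G])
    next
      case (Suc r)
      then show ?case
        using less.IH[of "n - 1"]
        by (auto simp: expand[where H = F and r = "Suc r" and n = n, OF F]
            expand[where H = G and r = "Suc r" and n = n, OF G])
    qed
    then show ?case by blast
  qed
  with \<open>r \<le> k\<close> show ?thesis
    by (intro fps_ext) blast
qed

section \<open>Path sums and their first-step recurrence\<close>

text \<open>Arbitrary integer endpoints are allowed so that the tail of a path is again covered,
  even if its start leaves the strip.\<close>

definition bounded_ms_sum ::
  "(nat \<Rightarrow> complex) \<Rightarrow> (nat \<Rightarrow> complex) \<Rightarrow> (nat \<Rightarrow> complex) \<Rightarrow>
     nat \<Rightarrow> int \<times> int \<Rightarrow> int \<times> int \<Rightarrow> complex" where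
  "bounded_ms_sum b a l k p q = (\<Sum>w\<in>bounded_ms_paths k p q. ms_weight b a l p w)"

lemma ms_points_translate:
  "ms_points (x + d, y) w = map (\<lambda>(u, v). (u + d, v)) (ms_points (x, y) w)"
proof (induction w arbitrary: x y)
  case (Cons t w)
  show ?case
    by (cases t) (simp_all add: Cons.IH[symmetric] algebra_simps)
qed simp

lemma ms_weight_translate: "ms_weight b a l (x + d, y) w = ms_weight b a l (x, y) w"
proof (induction w arbitrary: x y)
  case (Cons t w)
  show ?case
    using Cons.IH[of "fst (ms_move t (x, y))" "snd (ms_move t (x, y))"]
    by (cases t) (simp_all add: ac_simps)
qed simp

lemma bounded_ms_sum_translate:
  "bounded_ms_sum b a l k (x + d, y) (x' + d, y') = bounded_ms_sum b a l k (x, y) (x', y')"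
proof -
  have "bounded_ms_paths k (x + d, y) (x' + d, y') = bounded_ms_paths k (x, y) (x', y')"
  proof (rule set_eqI)
    fix w
    show "w \<in> bounded_ms_paths k (x + d, y) (x' + d, y') \<longleftrightarrow> w \<in> bounded_ms_paths k (x, y) (x', y')"
      by (cases "last (ms_points (x, y) w)")
        (simp add: bounded_ms_paths_def ms_paths_def ms_points_translate last_map case_prod_beta)
  qed
  then show ?thesis
    by (simp add: bounded_ms_sum_def ms_weight_translate)
qed

lemma fst_last_ms_points: "fst p \<le> fst (last (ms_points p w))"
proof (induction w arbitrary: p)
  case (Cons t w)
  show ?case
    using Cons.IH[of "ms_move t p"] by (cases t; cases p) auto
qed simp

lemma hd_ms_points: "p \<in> set (ms_points p w)"
  by (cases w) auto

text \<open>The start is itself a point of the path, and no step moves left, so there are no paths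
  at all.\<close>

lemma bounded_ms_sum_eq_0:
  assumes "snd p < 0 \<or> snd p > int k \<or> fst q < fst p"
  shows "bounded_ms_sum b a l k p q = 0"
proof -
  have "bounded_ms_paths k p q = {}"
  proof (intro equals0I)
    fix w assume "w \<in> bounded_ms_paths k p q"
    then have "last (ms_points p w) = q" "0 \<le> snd p" "snd p \<le> int k"
      using hd_ms_points[of p w] by (auto simp: bounded_ms_paths_def ms_paths_def case_prod_beta)
    with assms fst_last_ms_points[of p w] show False by auto
  qed
  then show ?thesis by (simp add: bounded_ms_sum_def)
qed

lemma bounded_ms_sum_first_step:
  assumes "0 \<le> h" "h \<le> int k"
  shows "bounded_ms_sum b a l k (x, h) q =
      (if (x, h) = q then 1 else 0) + bounded_ms_sum b a l k (x + 1, h + 1) q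
      + b (nat h) * bounded_ms_sum b a l k (x + 1, h) q
      + a (nat h) * bounded_ms_sum b a l k (x, h - 1) q
      + l (nat h) * bounded_ms_sum b a l k (x + 1, h - 1) q"
proof -
  let ?p = "(x, h)"
  let ?B = "\<lambda>t. Cons t ` bounded_ms_paths k (ms_move t ?p) q"
  let ?E = "if ?p = q then {[]} else {} :: ms_step list set"
  \<comment> \<open>As the start lies in the strip, the height constraint passes entirely to the
    tail.\<close>
  have mem: "w \<in> bounded_ms_paths k ?p q \<longleftrightarrow>
      (case w of [] \<Rightarrow> ?p = q | t # w' \<Rightarrow> w' \<in> bounded_ms_paths k (ms_move t ?p) q)" for w
    using assms by (cases w) (auto simp: bounded_ms_paths_def ms_paths_def)
  have split: "bounded_ms_paths k ?p q =
      ?E \<union> (?B Up \<union> (?B Horizontal \<union> (?B Vertical_Down \<union> ?B Diagonal_Down)))"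
  proof (rule set_eqI)
    fix w
    show "w \<in> bounded_ms_paths k ?p q \<longleftrightarrow>
        w \<in> ?E \<union> (?B Up \<union> (?B Horizontal \<union> (?B Vertical_Down \<union> ?B Diagonal_Down)))"
    proof (cases w)
      case (Cons t w')
      then show ?thesis by (cases t) (auto simp: mem)
    qed (auto simp: mem)
  qed
  have disj: "?E \<inter> ?B t = {}" "t \<noteq> t' \<Longrightarrow> ?B t \<inter> ?B t' = {}" for t t'
    by auto
  have B: "sum (ms_weight b a l ?p) (?B t) =
      ms_step_weight b a l (nat h) t * bounded_ms_sum b a l k (ms_move t ?p) q" for t
    by (subst sum.reindex) (simp_all add: bounded_ms_sum_def sum_distrib_left)
  have "bounded_ms_sum b a l k ?p q = sum (ms_weight b a l ?p) ?E
      + (sum (ms_weight b a l ?p) (?B Up) + (sum (ms_weight b a l ?p) (?B Horizontal)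
      + (sum (ms_weight b a l ?p) (?B Vertical_Down) + sum (ms_weight b a l ?p) (?B Diagonal_Down))))"
    unfolding bounded_ms_sum_def[of b a l k ?p] split
    by (simp add: sum.union_disjoint finite_bounded_ms_paths Int_Un_distrib disj
        del: ms_move.simps)
  then show ?thesis
    unfolding B by simp
qed

lemma bounded_moment_first_step:
  assumes "r \<le> k"
  shows "bounded_moment b a l k n r s = (if n = 0 \<and> r = s then 1 else 0)
      + (if n = 0 then 0 else b r * bounded_moment b a l k (n - 1) r s)
      + (if r < k \<and> n > 0 then bounded_moment b a l k (n - 1) (Suc r) s else 0)
      + (if r = 0 then 0 else a r * bounded_moment b a l k n (r - 1) s
          + (if n = 0 then 0 else l r * bounded_moment b a l k (n - 1) (r - 1) s))"
proof -
  define T where "T = bounded_ms_sum b a l k"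
  have moment: "bounded_moment b a l k m i s = T (0, int i) (int m, int s)" for m i
    by (simp add: T_def bounded_moment_def bounded_ms_sum_def)
  \<comment> \<open>Translating by one turns a start at abscissa 1 into target abscissa
    \<open>n - 1\<close>; for \<open>n = 0\<close> the target lies to the left of the start.\<close>
  have step: "T (1, h) (int n, int s) =
      (if n = 0 then 0 else T (0, h) (int (n - 1), int s))" for h
  proof (cases n)
    case 0
    then show ?thesis by (simp add: T_def bounded_ms_sum_eq_0)
  next
    case (Suc m)
    then show ?thesis
      using bounded_ms_sum_translate[of b a l k 0 1 h "int m" "int s"]
      by (simp add: T_def algebra_simps)
  qed
  have below: "T p q = 0" if "snd p < 0 \<or> snd p > int k" for p q
    using that by (auto simp: T_def intro: bounded_ms_sum_eq_0)
  have "T (0, int r) (int n, int s) = (if n = 0 \<and> r = s then 1 else 0)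
      + T (1, int r + 1) (int n, int s) + b r * T (1, int r) (int n, int s)
      + a r * T (0, int r - 1) (int n, int s) + l r * T (1, int r - 1) (int n, int s)"
    using bounded_ms_sum_first_step[of "int r" k b a l 0 "(int n, int s)"] assms
    by (auto simp: T_def)
  then show ?thesis
    using assms unfolding moment step
    by (auto simp: below of_nat_diff algebra_simps)
qed

lemma bounded_moment_fps_system:
  fixes b a l :: "nat \<Rightarrow> complex" and k s :: nat
  defines "F \<equiv> \<lambda>r. Abs_fps (\<lambda>n. bounded_moment b a l k n r s)"
  assumes "r \<le> k"
  shows "(1 - fps_const (b r) * fps_X) * F r =
      (if r = s then 1 else 0) + (if r < k then fps_X * F (Suc r) else 0)
      + (if r = 0 then 0 else (fps_const (a r) + fps_const (l r) * fps_X) * F (r - 1))"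
proof -
  have "F r = (if r = s then 1 else 0) + fps_const (b r) * (fps_X * F r)
      + (if r < k then fps_X * F (Suc r) else 0)
      + (if r = 0 then 0 else fps_const (a r) * F (r - 1)
          + fps_const (l r) * (fps_X * F (r - 1)))"
  proof (rule fps_ext)
    fix n
    show "F r $ n = ((if r = s then 1 else 0) + fps_const (b r) * (fps_X * F r)
      + (if r < k then fps_X * F (Suc r) else 0)
      + (if r = 0 then 0 else fps_const (a r) * F (r - 1)
          + fps_const (l r) * (fps_X * F (r - 1)))) $ n"
      using bounded_moment_first_step[OF assms(2), of b a l n s]
      by (auto simp: F_def)
  qed
  then show ?thesis
    by (simp only: fps_tridiagonal_row_iff)
qed

section \<open>Identification of the moments with the continuant solution\<close>

theorem theorem5p3:
  fixes b a l :: "nat \<Rightarrow> complex" and r s k :: nat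
  assumes "r \<le> k" and "s \<le> k"
  shows "(r \<le> s \<longrightarrow>
           Abs_fps (\<lambda>n. bounded_moment b a l k n r s) =
             fps_of_poly (rec_poly_star b a l r)
               * fps_of_poly (shifted_rec_poly_star (s + 1) b a l (k - s))
               / fps_of_poly (rec_poly_star b a l (k + 1)) * fps_X ^ (s - r)) \<and>
         (r > s \<longrightarrow>
           Abs_fps (\<lambda>n. bounded_moment b a l k n r s) =
             fps_of_poly (rec_poly_star b a l s)
               * fps_of_poly (shifted_rec_poly_star (r + 1) b a l (k - r))
               / fps_of_poly (rec_poly_star b a l (k + 1))
               * (\<Prod>i=s+1..r. fps_const (a i) + fps_const (l i) * fps_X))"
proof -
  define p where "p n = fps_of_poly (rec_poly_star b a l n)" for n
  define q where "q j = (if j \<le> Suc k then fps_of_poly (shifted_rec_poly_star j b a l (Suc k - j))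
      else 0)" for j
  define c where "c i = fps_const (a i) + fps_const (l i) * fps_X" for i
  define \<beta> where "\<beta> i = 1 - fps_const (b i) * fps_X" for i
  define N where "N i = (if i \<le> s then p i * q (Suc s) * fps_X ^ (s - i)
      else p s * q (Suc i) * (\<Prod>j=s+1..i. c j))" for i
  define u where "u = inverse (p (Suc k))"
  define F where "F i = Abs_fps (\<lambda>n. bounded_moment b a l k n i s)" for i
  have p_nz: "p n $ 0 \<noteq> 0" for n
    by (simp add: p_def coeff_0_rec_poly_star)
  have pu: "p (Suc k) * u = 1"
    unfolding u_def using p_nz by (simp add: inverse_mult_eq_1')
  have poly_\<beta>: "fps_of_poly [:1, - b i:] = \<beta> i" for i
    by (simp add: \<beta>_def fps_of_poly_pCons algebra_simps flip: fps_const_neg)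
  have poly_c: "fps_of_poly [:0, a i, l i:] = fps_X * c i" for i
    by (simp add: c_def fps_of_poly_pCons algebra_simps)
  have p_rec: "p (Suc (Suc n)) = \<beta> (Suc n) * p (Suc n) - fps_X * c (Suc n) * p n" for n
    by (simp only: p_def rec_poly_star_Suc_Suc fps_of_poly_diff fps_of_poly_mult poly_\<beta> poly_c)
  have q_rec: "q j = \<beta> j * q (Suc j) - fps_X * c (Suc j) * q (Suc (Suc j))" if "j \<le> k" for j
  \<comment> \<open>The first-index expansion needs length at least two. For \<open>j = k\<close>
    the length is one, and the default value of \<open>q\<close> beyond \<open>Suc k\<close> removes
    the last term.\<close>
  proof (cases "j = k")
    case True
    then show ?thesis
      by (simp add: q_def shifted_rec_poly_star_0 shifted_rec_poly_star_1 poly_\<beta>)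
  next
    case False
    with that obtain d where "k = Suc (j + d)"
      by (metis le_neq_implies_less less_iff_Suc_add)
    then show ?thesis
      by (simp add: q_def Suc_diff_le shifted_rec_poly_star_Suc_Suc fps_of_poly_diff
          fps_of_poly_mult poly_\<beta> poly_c del: mult_pCons_left)
  qed
  have N_rec: "\<beta> i * N i = (if i = s then p (Suc k) else 0) + fps_X * N (Suc i)
      + (if i = 0 then 0 else c i * N (i - 1))" if "i \<le> k" for i
    by (rule continuant_system[OF _ _ p_rec _ _ q_rec N_def that \<open>s \<le> k\<close>])
      (simp_all add: p_def q_def rec_poly_star_0 rec_poly_star_1 shifted_rec_poly_star_0 poly_\<beta>)
  \<comment> \<open>This matches the missing upward term in row \<open>k\<close> of the path
    system.\<close>
  have N_top: "N (Suc k) = 0"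
    using \<open>s \<le> k\<close> by (simp add: N_def q_def)
  \<comment> \<open>Scaling by \<open>u\<close> turns the right-hand side \<open>p (Suc k)\<close>
    of row \<open>s\<close> into 1, so both families solve the same system.\<close>
  have "F r = N r * u"
  proof (rule fps_tridiagonal_system_unique[where E = "\<lambda>i. if i = s then 1 else 0"
        and a = a and b = b and l = l and G = "\<lambda>i. N i * u", OF _ _ \<open>r \<le> k\<close>])
    fix i assume i: "i \<le> k"
    show "(1 - fps_const (b i) * fps_X) * F i =
        (if i = s then 1 else 0) + (if i < k then fps_X * F (Suc i) else 0)
        + (if i = 0 then 0 else (fps_const (a i) + fps_const (l i) * fps_X) * F (i - 1))"
      unfolding F_def by (rule bounded_moment_fps_system[OF i])
    have "\<beta> i * (N i * u) = (\<beta> i * N i) * u"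
      by (simp only: mult.assoc)
    also have "\<dots> = (if i = s then p (Suc k) * u else 0) + fps_X * (N (Suc i) * u)
        + (if i = 0 then 0 else c i * (N (i - 1) * u))"
      unfolding N_rec[OF i] by (simp add: algebra_simps)
    also have "fps_X * (N (Suc i) * u) = (if i < k then fps_X * (N (Suc i) * u) else 0)"
      using i N_top by (cases "i = k") auto
    finally show "(1 - fps_const (b i) * fps_X) * (N i * u) =
        (if i = s then 1 else 0) + (if i < k then fps_X * (N (Suc i) * u) else 0)
        + (if i = 0 then 0 else (fps_const (a i) + fps_const (l i) * fps_X) * (N (i - 1) * u))"
      unfolding pu \<beta>_def c_def .
  qed
  moreover have "f / p (Suc k) = f * u" for f
    unfolding u_def using p_nz by (rule fps_divide_unit)
  moreover have "q (Suc i) = fps_of_poly (shifted_rec_poly_star (i + 1) b a l (k - i))"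
    if "i \<le> k" for i
    using that by (simp add: q_def)
  ultimately show ?thesis
    using assms unfolding F_def N_def c_def p_def by (simp add: mult_ac)
qed

end
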